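(* For every constant $C>0$ there exists a constant $c>0$ such that for all integers $n\geq 3$ and $m$ with $n\leq m\leq C\,n e^{n}$ there exists a discrete MHR distribution $\mathcal D$ on $[0,\infty)$ such that, when the processing times $t_{ij}$ ($i\in\{1,\dots,n\}$, $j\in\{1,\dots,m\}$) are i.i.d. draws from $\mathcal D$, one has $0<\mathbb E[\mathrm{OPT}(\mathbf t)]<\infty$ and $$\frac{\mathbb E[\mathrm{VCG}(\mathbf t)]}{\mathbb E[\mathrm{OPT}(\mathbf t)]}\geq c\,\frac{\ln n}{\ln\ln n}.$$
   Context: There are $n$ machines and $m\ge n$ tasks; $t_{ij}\ge 0$ is the processing time of task $j$ on machine $i$, and $\mathbf t=(t_{ij})$. The VCG allocation assigns each task $j$ to a machine $i$ with $t_{ij}=\min_{i'}t_{i'j}$, ties being broken uniformly at random among the minimizing machines, independently for each task. With $\alpha_{ij}\in\{0,1\}$ indicating whether VCG assigns task $j$ to machine $i$, $\mathrm{VCG}(\mathbf t)=\max_i\sum_{j=1}^m\alpha_{ij}t_{ij}$ is its makespan. $\mathrm{OPT}(\mathbf t)$ is the minimum, over all assignments $a:\{1,\dots,m\}\to\{1,\dots,n\}$ of tasks to machines, of the makespan $\max_i\sum_{j:a(j)=i}t_{ij}$. Expectations are over $\mathbf t$ and the tie-breaking. A discrete distribution (of a random variable $X$) is MHR (monotone hazard rate) if its hazard rate $h(x)=\frac{\Pr[X=x]}{\Pr[X\geq x]}$ is weakly increasing over the points $x$ of its support. *)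

theory Defs
  imports "HOL-Probability.Probability"
begin

text \<open>
  A matrix of processing times is a function on pairs (machine, task), with machines
  \<open>{1..n}\<close> and tasks \<open>{1..m}\<close>; an assignment maps tasks to machines.
\<close>

definition makespan :: "nat \<Rightarrow> nat \<Rightarrow> (nat \<times> nat \<Rightarrow> real) \<Rightarrow> (nat \<Rightarrow> nat) \<Rightarrow> real" where
  "makespan n m t a = (MAX i\<in>{1..n}. \<Sum>j | j \<in> {1..m} \<and> a j = i. t (i, j))"

definition OPT :: "nat \<Rightarrow> nat \<Rightarrow> (nat \<times> nat \<Rightarrow> real) \<Rightarrow> real" where
  "OPT n m t = (MIN a\<in>{1..m} \<rightarrow>\<^sub>E {1..n}. makespan n m t a)"

definition fastest_machines :: "nat \<Rightarrow> (nat \<times> nat \<Rightarrow> real) \<Rightarrow> nat \<Rightarrow> nat set" where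
  "fastest_machines n t j = {i \<in> {1..n}. t (i, j) = (MIN i'\<in>{1..n}. t (i', j))}"

definition VCG_allocation :: "nat \<Rightarrow> nat \<Rightarrow> (nat \<times> nat \<Rightarrow> real) \<Rightarrow> (nat \<Rightarrow> nat) pmf" where
  "VCG_allocation n m t = Pi_pmf {1..m} 0 (\<lambda>j. pmf_of_set (fastest_machines n t j))"

definition VCG :: "nat \<Rightarrow> nat \<Rightarrow> (nat \<times> nat \<Rightarrow> real) \<Rightarrow> real pmf" where
  "VCG n m t = map_pmf (makespan n m t) (VCG_allocation n m t)"

definition iid_times :: "nat \<Rightarrow> nat \<Rightarrow> real pmf \<Rightarrow> (nat \<times> nat \<Rightarrow> real) pmf" where
  "iid_times n m D = Pi_pmf ({1..n} \<times> {1..m}) 0 (\<lambda>_. D)"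

text \<open>
  Expectations of these nonnegative random variables are taken in \<^typ>\<open>ennreal\<close>,
  so that finiteness is a genuine claim.
\<close>

definition expected_OPT :: "nat \<Rightarrow> nat \<Rightarrow> real pmf \<Rightarrow> ennreal" where
  "expected_OPT n m D = (\<integral>\<^sup>+ t. ennreal (OPT n m t) \<partial>measure_pmf (iid_times n m D))"

definition expected_VCG :: "nat \<Rightarrow> nat \<Rightarrow> real pmf \<Rightarrow> ennreal" where
  "expected_VCG n m D =
     (\<integral>\<^sup>+ x. ennreal x \<partial>measure_pmf (bind_pmf (iid_times n m D) (VCG n m)))"

definition hazard_rate :: "real pmf \<Rightarrow> real \<Rightarrow> real" where
  "hazard_rate D x = pmf D x / measure_pmf.prob D {x..}"

definition MHR :: "real pmf \<Rightarrow> bool" where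
  "MHR D \<longleftrightarrow> mono_on (set_pmf D) (hazard_rate D)"

end

theory Submission
  imports Defs
begin

text \<open>
  Every distribution on \<open>{0, 1}\<close> is MHR. Let 1 have probability \<open>q\<close> with
  \<open>q ^ n = n / m\<close>, and call a task slow if it takes time 1 on all machines; all other tasks can be
  processed in time 0, and on average there are \<open>n\<close> slow tasks. Balancing the slow tasks shows that
  \<open>OPT\<close> has expectation at most 2. VCG spreads the slow tasks uniformly at random, so
  its makespan is the maximum load when each of \<open>m\<close> balls independently
  lands in each of \<open>n\<close> bins with probability \<open>1 / m\<close> (and is discarded otherwise). A second moment argument
  shows that some bin receives at least \<open>k\<close> balls with probability at least 1/10 as soon as
  \<open>e * k ^ k \<le> n\<close>, which permits \<open>k\<close> of order \<open>ln n / ln (ln n)\<close>.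
\<close>

section \<open>The second moment method and an exponential estimate\<close>

text \<open>Let \<open>X\<close> count the events that occur, with mean \<open>\<mu>\<close>. The
  pair bound gives \<open>E[X^2] \<le> \<mu> + c * \<mu>^2\<close>, and \<open>\<mu> \<ge> 1\<close>
  turns this into \<open>(c + 1) * \<mu>^2\<close>. A second moment this close to the squared mean
  forces \<open>X\<close> to be nonzero with probability at least
  \<open>1 / (c + 1)\<close>.\<close>

lemma second_moment_prob_ge:
  fixes P :: "'a pmf" and E :: "'i \<Rightarrow> 'a set"
  assumes fin: "finite I" and c: "c \<ge> 0"
    and one: "(\<Sum>i\<in>I. measure_pmf.prob P (E i)) \<ge> 1"
    and pair: "\<And>i j. i \<in> I \<Longrightarrow> j \<in> I \<Longrightarrow> i \<noteq> j \<Longrightarrow>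
       measure_pmf.prob P (E i \<inter> E j) \<le> c * (measure_pmf.prob P (E i) * measure_pmf.prob P (E j))"
  shows "measure_pmf.prob P (\<Union>i\<in>I. E i) \<ge> 1 / (c + 1)"
proof -
  define \<mu> where "\<mu> = (\<Sum>i\<in>I. measure_pmf.prob P (E i))"
  define X where "X = (\<lambda>x. \<Sum>i\<in>I. indicator (E i) x :: real)"
  define l where "l = 1 / ((c + 1) * \<mu>)"
  have mu: "\<mu> \<ge> 1" using one by (simp add: \<mu>_def)
  have int1: "integrable (measure_pmf P) X"
    unfolding X_def by (intro Bochner_Integration.integrable_sum) (auto simp: measure_pmf.emeasure_eq_measure)
  have EX: "measure_pmf.expectation P X = \<mu>"
    unfolding X_def \<mu>_def by (subst Bochner_Integration.integral_sum) (auto simp: measure_pmf.emeasure_eq_measure)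
  have X2: "(X x)\<^sup>2 = (\<Sum>i\<in>I. \<Sum>j\<in>I. indicator (E i \<inter> E j) x)" for x
    by (simp add: X_def power2_eq_square sum_product indicator_inter_arith)
  have int2: "integrable (measure_pmf P) (\<lambda>x. (X x)\<^sup>2)"
    unfolding X2 by (intro Bochner_Integration.integrable_sum) (auto simp: measure_pmf.emeasure_eq_measure)
  have "measure_pmf.expectation P (\<lambda>x. (X x)\<^sup>2) = (\<Sum>i\<in>I. \<Sum>j\<in>I. measure_pmf.prob P (E i \<inter> E j))"
    unfolding X2 by (subst Bochner_Integration.integral_sum; (subst Bochner_Integration.integral_sum)?)
      (auto simp: measure_pmf.emeasure_eq_measure intro!: Bochner_Integration.integrable_sum)
  also have "\<dots> \<le> (\<Sum>i\<in>I. \<Sum>j\<in>I. (if i = j then measure_pmf.prob P (E i) else 0)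
      + c * (measure_pmf.prob P (E i) * measure_pmf.prob P (E j)))"
    using pair c by (intro sum_mono) auto
  also have "\<dots> = \<mu> + c * \<mu>\<^sup>2"
    using fin by (simp add: sum.distrib \<mu>_def power2_eq_square sum_product sum.delta flip: sum_distrib_left)
  finally have EX2: "measure_pmf.expectation P (\<lambda>x. (X x)\<^sup>2) \<le> \<mu> + c * \<mu>\<^sup>2" .
  \<comment> \<open>A quadratic minorant of the indicator of \<open>X \<noteq> 0\<close>; \<open>l\<close> is chosen to optimise its expectation.\<close>
  have ineq: "2 * l * X x - l\<^sup>2 * (X x)\<^sup>2 \<le> indicator (\<Union>i\<in>I. E i) x" for x
  proof (cases "x \<in> (\<Union>i\<in>I. E i)")
    case True
    have "0 \<le> (1 - l * X x)\<^sup>2" by simp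
    also have "(1 - l * X x)\<^sup>2 = 1 - (2 * l * X x - l\<^sup>2 * (X x)\<^sup>2)"
      by (simp add: power2_eq_square algebra_simps)
    finally show ?thesis using True by simp
  next
    case False
    then have "X x = 0" by (auto simp: X_def)
    then show ?thesis by simp
  qed
  have "1 / (c + 1) = 2 * l * \<mu> - l\<^sup>2 * ((c + 1) * \<mu>\<^sup>2)"
    using mu c by (simp add: l_def power2_eq_square divide_simps)
  also have "\<dots> \<le> 2 * l * \<mu> - l\<^sup>2 * (\<mu> + c * \<mu>\<^sup>2)"
  proof -
    have "\<mu> \<le> \<mu>\<^sup>2" using mu by (simp add: power2_eq_square)
    then have "l\<^sup>2 * (\<mu> + c * \<mu>\<^sup>2) \<le> l\<^sup>2 * ((c + 1) * \<mu>\<^sup>2)"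
      by (intro mult_left_mono) (auto simp: algebra_simps)
    then show ?thesis by simp
  qed
  also have "\<dots> \<le> 2 * l * measure_pmf.expectation P X - l\<^sup>2 * measure_pmf.expectation P (\<lambda>x. (X x)\<^sup>2)"
    using EX2 by (simp add: EX mult_left_mono)
  also have "\<dots> = measure_pmf.expectation P (\<lambda>x. 2 * l * X x - l\<^sup>2 * (X x)\<^sup>2)"
    using int1 int2 by simp
  also have "\<dots> \<le> measure_pmf.expectation P (indicator (\<Union>i\<in>I. E i))"
    using int1 int2 ineq by (intro integral_mono) (auto simp: measure_pmf.emeasure_eq_measure)
  finally show ?thesis by simp
qed

text \<open>Since \<open>1 - 1 / m\<close> is the reciprocal of \<open>1 + 1 / (m - 1)\<close>, this
  is \<open>(1 + 1 / (m - 1)) ^ (m - 1) \<le> e\<close> inverted. For \<open>m = 1\<close> the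
  right-hand side is \<open>0 ^ 0 = 1\<close>.\<close>

lemma exp_minus_one_le_power:
  assumes "m \<ge> 1" shows "exp (-1) \<le> (1 - 1 / real m) ^ (m - 1)"
proof (cases "m = 1")
  case False
  with assms have m: "m \<ge> 2" by simp
  have "(1 + 1 / real (m - 1)) ^ (m - 1) \<le> exp (1 / real (m - 1)) ^ (m - 1)"
    by (intro power_mono exp_ge_add_one_self) auto
  also have "\<dots> = exp 1" using m by (simp flip: exp_of_nat_mult)
  finally have "exp (-1) \<le> inverse ((1 + 1 / real (m - 1)) ^ (m - 1))"
    using m by (simp add: exp_minus add_pos_nonneg)
  also have "\<dots> = (inverse (1 + 1 / real (m - 1))) ^ (m - 1)" by (simp add: power_inverse)
  also have "inverse (1 + 1 / real (m - 1)) = 1 - 1 / real m"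
    using m by (simp add: of_nat_diff field_simps)
  finally show ?thesis .
qed simp

section \<open>Balls into bins\<close>

text \<open>
  The balls landing in bin \<open>i\<close> are exactly those in \<open>S\<close>. For \<open>i = i'\<close> and distinct \<open>S\<close>,
  \<open>S'\<close> these events are disjoint, and otherwise they are nearly negatively correlated.
\<close>

definition bin_event :: "nat \<Rightarrow> nat \<times> nat set \<Rightarrow> (nat \<Rightarrow> nat) set" where
  "bin_event m = (\<lambda>(i, S). Pi {1..m} (\<lambda>j. if j \<in> S then {i} else - {i}))"

lemma prob_bin_event:
  fixes Z :: "nat pmf"
  assumes pZ: "\<And>i. i \<in> {1..n} \<Longrightarrow> pmf Z i = p"
    and "i \<in> {1..n}" "S \<subseteq> {1..m}"
  shows "measure_pmf.prob (Pi_pmf {1..m} 0 (\<lambda>_. Z)) (bin_event m (i, S)) =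
    p ^ card S * (1 - p) ^ (m - card S)"
proof -
  have "measure_pmf.prob (Pi_pmf {1..m} 0 (\<lambda>_. Z)) (bin_event m (i, S))
      = (\<Prod>j\<in>{1..m}. if j \<in> S then p else 1 - p)"
    unfolding bin_event_def prod.case using assms pZ
    by (subst measure_Pi_pmf_Pi)
      (auto intro!: prod.cong
        simp: measure_pmf_single measure_pmf.prob_compl[of "{_}", simplified] Compl_eq_Diff_UNIV)
  also have "\<dots> = p ^ card ({1..m} \<inter> S) * (1 - p) ^ card ({1..m} - S)"
    by (simp add: prod.If_cases Diff_eq)
  finally show ?thesis using assms(3) by (simp add: Int_absorb1 card_Diff_subset finite_subset)
qed

text \<open>Independence allows a comparison ball by ball. A ball outside \<open>S\<close> and
  \<open>S'\<close> contributes \<open>1 - 2 * p \<le> (1 - p)^2\<close>; a ball in exactly one of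
  them contributes \<open>p\<close> against \<open>p * (1 - p)\<close>, which costs one factor
  \<open>1 / (1 - p)\<close>; a ball in both contributes 0.\<close>

lemma prob_bin_event_Int:
  fixes Z :: "nat pmf"
  assumes pZ: "\<And>i. i \<in> {1..n} \<Longrightarrow> pmf Z i = p"
    and "i \<in> {1..n}" "S \<subseteq> {1..m}" "i' \<in> {1..n}" "S' \<subseteq> {1..m}" "i \<noteq> i'" "p < 1"
  shows "measure_pmf.prob (Pi_pmf {1..m} 0 (\<lambda>_. Z)) (bin_event m (i, S) \<inter> bin_event m (i', S'))
    \<le> (1 / (1 - p)) ^ (card S + card S') *
      (measure_pmf.prob (Pi_pmf {1..m} 0 (\<lambda>_. Z)) (bin_event m (i, S)) *
       measure_pmf.prob (Pi_pmf {1..m} 0 (\<lambda>_. Z)) (bin_event m (i', S')))"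
proof -
  define B where "B = (\<lambda>(i::nat) S (j::nat). if j \<in> S then {i} else - {i})"
  have p0: "p \<ge> 0" using pZ[OF assms(2)] pmf_nonneg by metis
  have card_eq: "(\<Prod>j\<in>{1..m}. if j \<in> S then 1 / (1 - p) else 1) = (1 / (1 - p)) ^ card S"
    if "S \<subseteq> {1..m}" for S :: "nat set"
    using that by (simp add: prod.If_cases Int_absorb1)
  have "bin_event m (i, S) \<inter> bin_event m (i', S') = Pi {1..m} (\<lambda>j. B i S j \<inter> B i' S' j)"
    by (auto simp: bin_event_def B_def Pi_def)
  then have "measure_pmf.prob (Pi_pmf {1..m} 0 (\<lambda>_. Z)) (bin_event m (i, S) \<inter> bin_event m (i', S'))
      = (\<Prod>j\<in>{1..m}. measure_pmf.prob Z (B i S j \<inter> B i' S' j))"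
    by (simp add: measure_Pi_pmf_Pi)
  also have "\<dots> \<le> (\<Prod>j\<in>{1..m}. ((if j \<in> S then 1 / (1 - p) else 1) * (if j \<in> S' then 1 / (1 - p) else 1))
      * (measure_pmf.prob Z (B i S j) * measure_pmf.prob Z (B i' S' j)))"
  proof (rule prod_mono, rule conjI)
    fix j
    have s: "measure_pmf.prob Z {x} = p" "measure_pmf.prob Z (- {x}) = 1 - p" if "x \<in> {1..n}" for x
      using that pZ
      by (auto simp: measure_pmf_single Compl_eq_Diff_UNIV measure_pmf.prob_compl[of "{_}", simplified])
    have "measure_pmf.prob Z {i, i'} = p + p"
      using assms pZ by (subst measure_measure_pmf_finite) auto
    moreover have "- {i} \<inter> - {i'} = UNIV - {i, i'}" by auto
    ultimately have d: "measure_pmf.prob Z (- {i} \<inter> - {i'}) = 1 - 2 * p"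
      using measure_pmf.prob_compl[of "{i, i'}" Z] by simp
    have e: "{i} \<inter> - {i'} = {i}" "- {i} \<inter> {i'} = {i'}" "{i} \<inter> {i'} = {}" using assms by auto
    show "measure_pmf.prob Z (B i S j \<inter> B i' S' j) \<le>
      ((if j \<in> S then 1 / (1 - p) else 1) * (if j \<in> S' then 1 / (1 - p) else 1))
      * (measure_pmf.prob Z (B i S j) * measure_pmf.prob Z (B i' S' j))"
      using assms p0 unfolding B_def by (auto simp: e d s) (simp add: algebra_simps)
  qed simp
  also have "\<dots> = (1 / (1 - p)) ^ (card S + card S') *
      ((\<Prod>j\<in>{1..m}. measure_pmf.prob Z (B i S j)) * (\<Prod>j\<in>{1..m}. measure_pmf.prob Z (B i' S' j)))"
    using assms by (simp only: prod.distrib power_add card_eq)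
  also have "\<dots> = (1 / (1 - p)) ^ (card S + card S') *
      (measure_pmf.prob (Pi_pmf {1..m} 0 (\<lambda>_. Z)) (bin_event m (i, S)) *
       measure_pmf.prob (Pi_pmf {1..m} 0 (\<lambda>_. Z)) (bin_event m (i', S')))"
    by (simp add: bin_event_def B_def measure_Pi_pmf_Pi)
  finally show ?thesis .
qed

text \<open>The second moment bound is applied to the events that bin \<open>i\<close> receives
  exactly the balls in \<open>S\<close>, over all bins \<open>i\<close> and all \<open>S\<close> of
  size \<open>k\<close>. Their pairwise correlation is at most \<open>e^2 \<le> 9\<close>, whence
  \<open>1 / (9 + 1)\<close>.\<close>

lemma balls_into_bins_prob_ge:
  fixes Z :: "nat pmf"
  assumes "n \<le> m" "1 \<le> k" "exp 1 * real k ^ k \<le> real n"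
    and pZ: "\<And>i. i \<in> {1..n} \<Longrightarrow> pmf Z i = 1 / real m"
  shows "measure_pmf.prob (Pi_pmf {1..m} 0 (\<lambda>_. Z))
      {z. \<exists>i\<in>{1..n}. k \<le> card {j \<in> {1..m}. z j = i}} \<ge> 1 / 10"
proof -
  define P where "P = Pi_pmf {1..m} 0 (\<lambda>_. Z)"
  define I where "I = {1..n} \<times> {S. S \<subseteq> {1..m} \<and> card S = k}"
  have "real k \<le> real k ^ k" using assms(2) by (simp add: self_le_power)
  \<comment> \<open>The factor \<open>e\<close> makes \<open>k < n\<close> strict, so that the
    exponents \<open>k\<close> and \<open>m - k\<close> below are both at most \<open>m - 1\<close>
    and \<open>exp_minus_one_le_power\<close> bounds both powers.\<close>
  have "real k < exp 1 * real k" using assms(2) by simp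
  also have "\<dots> \<le> exp 1 * real k ^ k" using \<open>real k \<le> real k ^ k\<close> by simp
  finally have kn: "k < n" using assms(3) by linarith
  have m: "m \<ge> 1" "k \<le> m - 1" "m > 1" using kn assms by auto
  have finI: "finite I" by (simp add: I_def)
  have prob: "measure_pmf.prob P (bin_event m x) = (1 / real m) ^ k * (1 - 1 / real m) ^ (m - k)"
    if "x \<in> I" for x
    using that prob_bin_event[of n Z "1 / real m" "fst x" "snd x" m] m pZ by (auto simp: P_def I_def)
  have "1 / (9 + 1) \<le> measure_pmf.prob P (\<Union>x\<in>I. bin_event m x)"
  proof (rule second_moment_prob_ge[OF finI])
    \<comment> \<open>The expected number of events is at least \<open>n / (e * k ^ k)\<close>, by
      \<open>(m choose k) \<ge> (m / k) ^ k\<close>; the hypothesis on \<open>k\<close> says exactly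
      that this is at least 1.\<close>
    have "1 \<le> real n * (1 / real k) ^ k * exp (-1)"
      using assms(2,3) by (simp add: exp_minus field_simps)
    also have "\<dots> = real n * ((real m / real k) ^ k * ((1 / real m) ^ k * exp (-1)))"
      using m by (simp add: field_simps)
    also have "\<dots> \<le> real n * (real (m choose k) * ((1 / real m) ^ k * (1 - 1 / real m) ^ (m - k)))"
    proof -
      have "exp (-1) \<le> (1 - 1 / real m) ^ (m - 1)" using m by (intro exp_minus_one_le_power) auto
      also have "\<dots> \<le> (1 - 1 / real m) ^ (m - k)"
        using m assms(2) by (intro power_decreasing) auto
      finally have *: "exp (-1) \<le> (1 - 1 / real m) ^ (m - k)" .
      show ?thesis
        using m * binomial_ge_n_over_k_pow_k[of k m, where 'a = real]
        by (intro mult_left_mono mult_mono) auto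
    qed
    also have "\<dots> = (\<Sum>x\<in>I. measure_pmf.prob P (bin_event m x))"
      using prob by (simp add: I_def card_cartesian_product n_subsets)
    finally show "1 \<le> (\<Sum>x\<in>I. measure_pmf.prob P (bin_event m x))" .
  next
    fix x y assume xy: "x \<in> I" "y \<in> I" "x \<noteq> y"
    obtain i S i' S' where [simp]: "x = (i, S)" "y = (i', S')" by (cases x, cases y)
    have S: "S \<subseteq> {1..m}" "S' \<subseteq> {1..m}" "card S = k" "card S' = k" "i \<in> {1..n}" "i' \<in> {1..n}"
      using xy by (auto simp: I_def)
    show "measure_pmf.prob P (bin_event m x \<inter> bin_event m y)
        \<le> 9 * (measure_pmf.prob P (bin_event m x) * measure_pmf.prob P (bin_event m y))"
    proof (cases "i = i'")
      case True
      with xy have "S \<noteq> S'" by auto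
      \<comment> \<open>Ball \<open>j\<close> would have to lie both inside and outside bin
        \<open>i\<close>.\<close>
      then obtain j where "j \<in> {1..m}" "(j \<in> S) \<noteq> (j \<in> S')" using S by blast
      then have "bin_event m x \<inter> bin_event m y = {}" 
        using True by (force simp: bin_event_def Pi_iff)
      then show ?thesis by simp
    next
      case False
      have "(1 / (1 - 1 / real m)) ^ (k + k) = inverse (((1 - 1 / real m) ^ k)\<^sup>2)"
        by (simp add: power_add power2_eq_square power_one_over inverse_eq_divide)
      also have "\<dots> \<le> inverse ((exp (-1))\<^sup>2)"
      proof (intro le_imp_inverse_le power_mono)
        have "exp (-1) \<le> (1 - 1 / real m) ^ (m - 1)" using m by (intro exp_minus_one_le_power) auto
        also have "\<dots> \<le> (1 - 1 / real m) ^ k" using m by (intro power_decreasing) auto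
        finally show "exp (-1) \<le> (1 - 1 / real m) ^ k" .
      qed auto
      also have "\<dots> = (exp 1)\<^sup>2" by (simp add: exp_minus power_inverse)
      also have "\<dots> \<le> 3\<^sup>2" by (intro power_mono exp_le) auto
      finally have 9: "(1 / (1 - 1 / real m)) ^ (k + k) \<le> 9" by simp
      have "measure_pmf.prob P (bin_event m x \<inter> bin_event m y)
          \<le> (1 / (1 - 1 / real m)) ^ (k + k) * (measure_pmf.prob P (bin_event m x) * measure_pmf.prob P (bin_event m y))"
        using prob_bin_event_Int[of n Z "1 / real m" i S m i' S'] m pZ S False by (simp add: P_def)
      also have "\<dots> \<le> 9 * (measure_pmf.prob P (bin_event m x) * measure_pmf.prob P (bin_event m y))"
        using 9 by (intro mult_right_mono) auto
      finally show ?thesis .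
    qed
  qed simp
  also have "\<dots> \<le> measure_pmf.prob P {z. \<exists>i\<in>{1..n}. k \<le> card {j \<in> {1..m}. z j = i}}"
  proof (rule measure_pmf.finite_measure_mono)
    show "(\<Union>x\<in>I. bin_event m x) \<subseteq> {z. \<exists>i\<in>{1..n}. k \<le> card {j \<in> {1..m}. z j = i}}"
    proof clarify
      fix z i S assume *: "(i, S) \<in> I" "z \<in> bin_event m (i, S)"
      then have "{j \<in> {1..m}. z j = i} = S"
        by (auto simp: I_def bin_event_def Pi_iff split: if_splits)
      with * show "\<exists>i\<in>{1..n}. k \<le> card {j \<in> {1..m}. z j = i}" by (auto simp: I_def)
    qed
  qed simp
  finally show ?thesis by (simp add: P_def)
qed


section \<open>The two-point distribution\<close>

definition two_point :: "real \<Rightarrow> real pmf" where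
  "two_point q = map_pmf of_bool (bernoulli_pmf q)"

lemma set_two_point: "set_pmf (two_point q) \<subseteq> {0, 1}"
  by (auto simp: two_point_def)

lemma pmf_two_point_one:
  assumes "0 \<le> q" "q \<le> 1"
  shows "pmf (two_point q) 1 = q"
proof -
  have "inj (of_bool :: bool \<Rightarrow> real)" by (auto simp: inj_def)
  from pmf_map_inj'[OF this, of "bernoulli_pmf q" True] assms show ?thesis
    by (simp add: two_point_def)
qed

text \<open>A hazard rate never exceeds 1, and at 1, the largest possible point of the support, it
  equals 1.\<close>

lemma MHR_two_point: "MHR (two_point q)"
proof -
  have le: "hazard_rate (two_point q) x \<le> 1" for x
    unfolding hazard_rate_def measure_pmf_single[symmetric]
    by (intro divide_le_eq_1[THEN iffD2])
       (auto intro!: measure_pmf.finite_measure_mono simp: zero_less_measure_iff)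
  have "hazard_rate (two_point q) 1 = 1" if "1 \<in> set_pmf (two_point q)"
  proof -
    have "measure_pmf.prob (two_point q) {1..} = measure_pmf.prob (two_point q) {1}"
      using set_two_point[of q] by (intro measure_pmf.finite_measure_eq_AE AE_pmfI) auto
    with that show ?thesis
      by (simp add: hazard_rate_def measure_pmf_single set_pmf_iff)
  qed
  with le show ?thesis
    unfolding MHR_def using set_two_point[of q]
    by (intro mono_onI) (metis insertE order.antisym order.refl singletonD subsetD zero_le_one)
qed

section \<open>Slow tasks and the law of their VCG allocation\<close>

text \<open>Regroups an i.i.d. matrix into independent columns, so that the tasks can be treated as
  independent balls. Reindexing is injective, so the two mass functions can be compared pointwise;
  the default column is constantly \<open>d\<close>.\<close>

lemma Pi_pmf_Times:
  assumes "finite A" "finite B"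
  shows "Pi_pmf (A \<times> B) d (\<lambda>_. D) =
    map_pmf (\<lambda>F (i, j). F j i) (Pi_pmf B (\<lambda>_. d) (\<lambda>_. Pi_pmf A d (\<lambda>_. D)))"
proof (rule pmf_eqI)
  fix f :: "'a \<times> 'b \<Rightarrow> 'c"
  define G :: "('b \<Rightarrow> 'a \<Rightarrow> 'c) \<Rightarrow> 'a \<times> 'b \<Rightarrow> 'c" where "G = (\<lambda>F (i, j). F j i)"
  define F where "F = (\<lambda>j i. f (i, j))"
  have "inj G" by (auto simp: inj_def G_def fun_eq_iff)
  have f: "f = G F" by (auto simp: G_def F_def)
  have "pmf (Pi_pmf (A \<times> B) d (\<lambda>_. D)) f = pmf (Pi_pmf B (\<lambda>_. d) (\<lambda>_. Pi_pmf A d (\<lambda>_. D))) F"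
  proof (cases "\<forall>x. x \<notin> A \<times> B \<longrightarrow> f x = d")
    case True
    have "pmf (Pi_pmf (A \<times> B) d (\<lambda>_. D)) f = (\<Prod>x\<in>A \<times> B. pmf D (f x))"
      using assms True by (simp add: pmf_Pi)
    also have "\<dots> = (\<Prod>i\<in>A. \<Prod>j\<in>B. pmf D (f (i, j)))"
      by (simp add: prod.cartesian_product case_prod_unfold)
    also have "\<dots> = (\<Prod>j\<in>B. \<Prod>i\<in>A. pmf D (f (i, j)))" by (rule prod.swap)
    also have "\<dots> = pmf (Pi_pmf B (\<lambda>_. d) (\<lambda>_. Pi_pmf A d (\<lambda>_. D))) F"
      using assms True by (subst pmf_Pi') (auto simp: F_def pmf_Pi intro!: prod.cong)
    finally show ?thesis .
  next
    case False
    \<comment> \<open>Both masses vanish: if \<open>j \<in> B\<close>, column \<open>j\<close> is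
      itself impossible because \<open>i\<close> is outside \<open>A\<close>; otherwise column
      \<open>j\<close> differs from the default column.\<close>
    then obtain i j where ij: "(i, j) \<notin> A \<times> B" "f (i, j) \<noteq> d" by auto
    have "pmf (Pi_pmf B (\<lambda>_. d) (\<lambda>_. Pi_pmf A d (\<lambda>_. D))) F = 0"
    proof (cases "j \<in> B")
      case True
      then have "pmf (Pi_pmf A d (\<lambda>_. D)) (F j) = 0"
        using ij assms by (intro pmf_Pi_outside) (auto simp: F_def)
      then show ?thesis using assms True by (subst pmf_Pi) (auto intro!: prod_zero)
    next
      case False
      then show ?thesis using ij assms by (intro pmf_Pi_outside) (auto simp: F_def fun_eq_iff)
    qed
    moreover have "pmf (Pi_pmf (A \<times> B) d (\<lambda>_. D)) f = 0"
      using ij assms by (intro pmf_Pi_outside) auto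
    ultimately show ?thesis by simp
  qed
  then show "pmf (Pi_pmf (A \<times> B) d (\<lambda>_. D)) f =
      pmf (map_pmf (\<lambda>F (i, j). F j i) (Pi_pmf B (\<lambda>_. d) (\<lambda>_. Pi_pmf A d (\<lambda>_. D)))) f"
    using pmf_map_inj'[OF \<open>inj G\<close>] by (simp add: G_def[symmetric] f)
qed

definition slow_tasks :: "nat \<Rightarrow> nat \<Rightarrow> (nat \<times> nat \<Rightarrow> real) \<Rightarrow> nat set" where
  "slow_tasks n m t = {j \<in> {1..m}. \<forall>i\<in>{1..n}. t (i, j) = 1}"

text \<open>Machine 0 does not exist; it stands for tasks that are not slow.\<close>

definition slow_allocation :: "nat \<Rightarrow> nat \<Rightarrow> (nat \<times> nat \<Rightarrow> real) \<Rightarrow> (nat \<Rightarrow> nat) \<Rightarrow> nat \<Rightarrow> nat" where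
  "slow_allocation n m t a = (\<lambda>j. if j \<in> slow_tasks n m t then a j else 0)"

text \<open>The bin of a single ball: \<open>s\<close> is the task's column of times, and on a slow
  column all machines tie, so VCG chooses uniformly. The value 0 is a discarded ball.\<close>

definition slow_bin :: "nat \<Rightarrow> real pmf \<Rightarrow> nat pmf" where
  "slow_bin n D = bind_pmf (Pi_pmf {1..n} 0 (\<lambda>_. D))
     (\<lambda>s. if \<forall>i\<in>{1..n}. s i = 1 then pmf_of_set {1..n} else return_pmf 0)"

text \<open>For a slow task every machine is fastest; for any other task the choice of VCG is
  overwritten by 0. The masking acts on each task separately, so it preserves the product
  form.\<close>

lemma map_VCG_allocation_slow:
  assumes "n \<ge> 1"
  shows "map_pmf (slow_allocation n m t) (VCG_allocation n m t) =
    Pi_pmf {1..m} 0 (\<lambda>j. if \<forall>i\<in>{1..n}. t (i, j) = 1 then pmf_of_set {1..n} else return_pmf 0)"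
    (is "_ = Pi_pmf _ _ ?K")
proof -
  have K: "?K j = bind_pmf (pmf_of_set (fastest_machines n t j))
      (\<lambda>x. return_pmf (if \<forall>i\<in>{1..n}. t (i, j) = 1 then x else 0))" for j
  proof (cases "\<forall>i\<in>{1..n}. t (i, j) = 1")
    case True
    then have "(\<lambda>i'. t (i', j)) ` {1..n} = {1}" using assms by force
    then have "fastest_machines n t j = {1..n}"
      using True by (auto simp: fastest_machines_def)
    with True show ?thesis by (simp add: bind_return_pmf')
  next
    case False
    show ?thesis unfolding if_not_P[OF False] by simp
  qed
  show ?thesis
    unfolding K VCG_allocation_def
    by (subst Pi_pmf_bind[where d' = 0])
       (auto simp: map_pmf_def slow_allocation_def slow_tasks_def fun_eq_iff intro!: bind_pmf_cong)
qed

text \<open>The bridge to balls into bins: averaged over the times, the masked choices for distinct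
  tasks depend on distinct columns and independent tie-breaking, so they are i.i.d.\<close>

lemma slow_allocation_iid:
  assumes "n \<ge> 1"
  shows "bind_pmf (iid_times n m D) (\<lambda>t. map_pmf (slow_allocation n m t) (VCG_allocation n m t)) =
    Pi_pmf {1..m} 0 (\<lambda>_. slow_bin n D)"
  unfolding map_VCG_allocation_slow[OF assms] iid_times_def slow_bin_def
  by (simp add: Pi_pmf_Times bind_map_pmf Pi_pmf_bind[where d' = "\<lambda>_. 0"] cong: if_cong)

text \<open>All \<open>n\<close> times must be 1, and then the tie must fall on \<open>i\<close>.
  When the first probability is \<open>n / m\<close>, this yields the value \<open>1 / m\<close>
  required by \<open>balls_into_bins_prob_ge\<close>.\<close>

lemma pmf_slow_bin:
  assumes "i \<in> {1..n}"
  shows "pmf (slow_bin n D) i = pmf D 1 ^ n / real n"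
proof -
  have "pmf (slow_bin n D) i = measure_pmf.expectation (Pi_pmf {1..n} 0 (\<lambda>_. D))
      (\<lambda>s. indicator (Pi {1..n} (\<lambda>_. {1})) s / real n)"
    unfolding slow_bin_def pmf_bind using assms
    by (intro Bochner_Integration.integral_cong) (auto simp: Pi_iff indicator_def)
  also have "\<dots> = measure_pmf.prob (Pi_pmf {1..n} 0 (\<lambda>_. D)) (Pi {1..n} (\<lambda>_. {1})) / real n"
    by simp
  also have "\<dots> = pmf D 1 ^ n / real n"
    by (subst measure_Pi_pmf_Pi) (auto simp: measure_pmf_single)
  finally show ?thesis .
qed

lemma prob_slow_task:
  assumes "j \<in> {1..m}"
  shows "measure_pmf.prob (iid_times n m D) {t. j \<in> slow_tasks n m t} = pmf D 1 ^ n"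
proof -
  have "{t. j \<in> slow_tasks n m t} = Pi ({1..n} \<times> {1..m}) (\<lambda>x. if snd x = j then {1} else UNIV)"
  proof (intro set_eqI iffI)
    fix t :: "nat \<times> nat \<Rightarrow> real"
    assume t: "t \<in> Pi ({1..n} \<times> {1..m}) (\<lambda>x. if snd x = j then {1} else UNIV)"
    have "t (i, j) = 1" if "i \<in> {1..n}" for i
      using Pi_mem[OF t, of "(i, j)"] that assms by simp
    with assms show "t \<in> {t. j \<in> slow_tasks n m t}" by (simp add: slow_tasks_def)
  qed (auto simp: slow_tasks_def)
  then have "measure_pmf.prob (iid_times n m D) {t. j \<in> slow_tasks n m t} =
      (\<Prod>x\<in>{1..n} \<times> {1..m}. measure_pmf.prob D (if snd x = j then {1} else UNIV))"
    by (simp add: iid_times_def measure_Pi_pmf_Pi)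
  also have "\<dots> = (\<Prod>i\<in>{1..n}. \<Prod>j'\<in>{1..m}. if j' = j then pmf D 1 else 1)"
    unfolding prod.cartesian_product
    by (intro prod.cong) (auto simp: measure_pmf_single)
  also have "\<dots> = pmf D 1 ^ n" using assms by simp
  finally show ?thesis .
qed

text \<open>The extra 0 is the default value of \<open>Pi_pmf\<close> outside the index
  rectangle.\<close>

lemma iid_times_range:
  assumes "t \<in> set_pmf (iid_times n m D)"
  shows "t x \<in> insert 0 (set_pmf D)"
proof -
  have t: "t \<in> PiE_dflt ({1..n} \<times> {1..m}) 0 (\<lambda>_. set_pmf D)"
    using assms by (simp add: iid_times_def set_Pi_pmf comp_def)
  show ?thesis
  proof (cases "x \<in> {1..n} \<times> {1..m}")
    case True
    with t have "t x \<in> set_pmf D" unfolding PiE_dflt_def by blast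
    then show ?thesis by simp
  next
    case False
    with t have "t x = 0" unfolding PiE_dflt_def by blast
    then show ?thesis by simp
  qed
qed

section \<open>Lower bound on the expected VCG makespan\<close>

lemma makespan_ge:
  assumes "i \<in> {1..n}"
  shows "(\<Sum>j | j \<in> {1..m} \<and> a j = i. t (i, j)) \<le> makespan n m t a"
  unfolding makespan_def using assms by (intro Max_ge) auto

text \<open>Each slow task adds exactly 1 to the load of its machine and the other tasks add a
  nonnegative amount. As \<open>i \<ge> 1\<close>, the marker 0 of masked tasks is never
  counted.\<close>

lemma makespan_ge_slow_card:
  assumes "\<And>x. t x \<ge> 0" "i \<in> {1..n}"
  shows "real (card {j \<in> {1..m}. slow_allocation n m t a j = i}) \<le> makespan n m t a"
proof -
  have "real (card {j \<in> {1..m}. slow_allocation n m t a j = i}) =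
      (\<Sum>j | j \<in> {1..m} \<and> slow_allocation n m t a j = i. t (i, j))"
    using assms(2) by (subst sum.cong[OF refl, where h = "\<lambda>_. 1"])
      (auto simp: slow_allocation_def slow_tasks_def split: if_splits)
  also have "\<dots> \<le> (\<Sum>j | j \<in> {1..m} \<and> a j = i. t (i, j))"
    using assms by (intro sum_mono2) (auto simp: slow_allocation_def split: if_splits)
  also have "\<dots> \<le> makespan n m t a" using assms(2) by (rule makespan_ge)
  finally show ?thesis .
qed

lemma expected_VCG_ge:
  assumes "n \<ge> 1" "set_pmf D \<subseteq> {0..}"
  shows "expected_VCG n m D \<ge> ennreal (real k * measure_pmf.prob (Pi_pmf {1..m} 0 (\<lambda>_. slow_bin n D))
      {z. \<exists>i\<in>{1..n}. k \<le> card {j \<in> {1..m}. z j = i}})"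
proof -
  define A where "A = {z. \<exists>i\<in>{1..n}. k \<le> card {j \<in> {1..m}. z j = (i::nat)}}"
  have "ennreal (real k * measure_pmf.prob (Pi_pmf {1..m} 0 (\<lambda>_. slow_bin n D)) A) =
      (\<integral>\<^sup>+ z. ennreal (real k) * indicator A z \<partial>Pi_pmf {1..m} 0 (\<lambda>_. slow_bin n D))"
    by (simp add: nn_integral_cmult_indicator measure_pmf.emeasure_eq_measure ennreal_mult)
  also have "\<dots> = (\<integral>\<^sup>+ t. \<integral>\<^sup>+ a. ennreal (real k) * indicator A (slow_allocation n m t a)
      \<partial>VCG_allocation n m t \<partial>iid_times n m D)"
    by (subst slow_allocation_iid[OF assms(1), symmetric]) (simp only: nn_integral_bind_pmf nn_integral_map_pmf)
  also have "\<dots> \<le> (\<integral>\<^sup>+ t. \<integral>\<^sup>+ a. ennreal (makespan n m t a) \<partial>VCG_allocation n m t \<partial>iid_times n m D)"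
  proof (rule nn_integral_mono_AE, rule AE_pmfI, rule nn_integral_mono)
    fix t a assume "t \<in> set_pmf (iid_times n m D)"
    then have t: "t x \<ge> 0" for x
      using iid_times_range[of t n m D x] assms(2) by auto
    show "ennreal (real k) * indicator A (slow_allocation n m t a) \<le> ennreal (makespan n m t a)"
    proof (cases "slow_allocation n m t a \<in> A")
      case True
      then obtain i where "i \<in> {1..n}" "k \<le> card {j \<in> {1..m}. slow_allocation n m t a j = i}"
        by (auto simp: A_def)
      with makespan_ge_slow_card[of t i n m a, OF t this(1)] True show ?thesis
        by (auto intro!: ennreal_leI)
    qed simp
  qed
  also have "\<dots> = expected_VCG n m D"
    by (simp add: expected_VCG_def VCG_def)
  finally show ?thesis by (simp add: A_def)
qed

section \<open>Bounds on the expected optimum\<close>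

lemma finite_makespans: "finite (makespan n m t ` ({1..m} \<rightarrow>\<^sub>E {1..n}))"
  by (intro finite_imageI finite_PiE) auto

lemma makespans_nonempty: "n \<ge> 1 \<Longrightarrow> makespan n m t ` ({1..m} \<rightarrow>\<^sub>E {1..n}) \<noteq> {}"
  by (auto simp: PiE_eq_empty_iff)

text \<open>Within a residue class the quotient determines the number, and it is at most
  \<open>b div n\<close>. This bounds the load of a machine under round-robin.\<close>

lemma card_mod_class_le:
  fixes n b r :: nat
  assumes "n \<ge> 1"
  shows "real (card {x. x < b \<and> x mod n = r}) \<le> real b / real n + 1"
proof -
  have "card {x. x < b \<and> x mod n = r} \<le> card {..b div n}"
  proof (rule card_inj_on_le[where f = "\<lambda>x. x div n"])
    show "inj_on (\<lambda>x. x div n) {x. x < b \<and> x mod n = r}"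
      by (rule inj_onI) (metis (mono_tags, lifting) div_mod_decomp mem_Collect_eq)
    show "(\<lambda>x. x div n) ` {x. x < b \<and> x mod n = r} \<subseteq> {..b div n}"
      by (auto intro: div_le_mono)
  qed simp
  also have "\<dots> = b div n + 1" by simp
  finally have "real (card {x. x < b \<and> x mod n = r}) \<le> real (b div n) + 1"
    by (simp flip: of_nat_Suc)
  also have "real (b div n) \<le> real b / real n"
  proof -
    have "real (b div n) * real n \<le> real b"
      by (metis div_times_less_eq_dividend of_nat_le_iff of_nat_mult)
    then show ?thesis using assms by (simp add: pos_le_divide_eq)
  qed
  finally show ?thesis by simp
qed

text \<open>The bound is witnessed by an assignment that deals out the slow tasks in round-robin
  order and sends every other task to a machine where it takes time 0.\<close>

lemma OPT_le:
  assumes n: "n \<ge> 1" and t: "\<And>x. t x \<in> {0, 1}"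
  shows "OPT n m t \<le> real (card (slow_tasks n m t)) / real n + 1"
proof -
  define B where "B = slow_tasks n m t"
  have B_sub: "B \<subseteq> {1..m}" by (auto simp: B_def slow_tasks_def)
  then have "finite B" by (rule finite_subset) simp
  then obtain e where e: "bij_betw e B {0..<card B}" using ex_bij_betw_finite_nat by blast
  have "\<exists>i\<in>{1..n}. t (i, j) = 0" if "j \<in> {1..m} - B" for j
    using that t by (force simp: B_def slow_tasks_def)
  then obtain g where g: "\<And>j. j \<in> {1..m} - B \<Longrightarrow> g j \<in> {1..n} \<and> t (g j, j) = 0" by metis
  \<comment> \<open>\<open>e\<close> numbers the slow tasks from 0; the shift by 1 turns residues
    into machine indices.\<close>
  define a where "a = (\<lambda>j\<in>{1..m}. if j \<in> B then e j mod n + 1 else g j)"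
  have a: "a \<in> {1..m} \<rightarrow>\<^sub>E {1..n}"
    using g n by (auto simp: a_def Suc_le_eq)
  have load: "(\<Sum>j | j \<in> {1..m} \<and> a j = i. t (i, j)) \<le> real (card B) / real n + 1" for i
  proof -
    have "(\<Sum>j | j \<in> {1..m} \<and> a j = i. t (i, j)) = (\<Sum>j | j \<in> B \<and> e j mod n + 1 = i. t (i, j))"
    proof (rule sum.mono_neutral_right)
      show "{j. j \<in> B \<and> e j mod n + 1 = i} \<subseteq> {j. j \<in> {1..m} \<and> a j = i}"
        using B_sub by (auto simp: a_def)
      show "\<forall>j\<in>{j. j \<in> {1..m} \<and> a j = i} - {j. j \<in> B \<and> e j mod n + 1 = i}. t (i, j) = 0"
      proof
        fix j assume j: "j \<in> {j. j \<in> {1..m} \<and> a j = i} - {j. j \<in> B \<and> e j mod n + 1 = i}"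
        then have "j \<in> {1..m} - B" "g j = i" by (auto simp: a_def split: if_splits)
        with g[of j] show "t (i, j) = 0" by simp
      qed
    qed simp
    also have "\<dots> \<le> (\<Sum>j | j \<in> B \<and> e j mod n + 1 = i. 1)"
    proof (rule sum_mono)
      fix j show "t (i, j) \<le> 1" using t[of "(i, j)"] by auto
    qed
    also have "\<dots> = real (card {j \<in> B. e j mod n + 1 = i})" by simp
    also have "\<dots> \<le> real (card {x. x < card B \<and> x mod n = i - 1})"
      using e by (intro of_nat_mono card_inj_on_le[where f = e])
        (auto simp: bij_betw_def inj_on_def)
    also have "\<dots> \<le> real (card B) / real n + 1" using n by (rule card_mod_class_le)
    finally show ?thesis .
  qed
  have "OPT n m t \<le> makespan n m t a"
    unfolding OPT_def using a finite_makespans by (intro Min_le) auto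
  also have "\<dots> \<le> real (card B) / real n + 1"
    unfolding makespan_def using n load by (intro Max.boundedI) auto
  finally show ?thesis by (simp add: B_def)
qed

lemma expected_OPT_le:
  assumes n: "n \<ge> 1" and D: "set_pmf D \<subseteq> {0, 1}"
  shows "expected_OPT n m D \<le> ennreal (real m * pmf D 1 ^ n / real n + 1)"
proof -
  \<comment> \<open>The bound of \<open>OPT_le\<close>, with the number of slow tasks written as a
    sum of indicators so that linearity of expectation applies.\<close>
  define f where "f = (\<lambda>t. (\<Sum>j\<in>{1..m}. indicat_real {t. j \<in> slow_tasks n m t} t) / real n + 1)"
  have card_eq: "real (card (slow_tasks n m t)) = (\<Sum>j\<in>{1..m}. indicator {t. j \<in> slow_tasks n m t} t)" for t
  proof -
    have "slow_tasks n m t = {1..m} \<inter> {j. j \<in> slow_tasks n m t}" by (auto simp: slow_tasks_def)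
    then show ?thesis by (simp add: indicator_def)
  qed
  have int: "integrable (measure_pmf (iid_times n m D)) f"
    unfolding f_def by (auto simp: measure_pmf.emeasure_eq_measure)
  have "expected_OPT n m D \<le> (\<integral>\<^sup>+ t. ennreal (f t) \<partial>iid_times n m D)"
    unfolding expected_OPT_def
  proof (intro nn_integral_mono_AE AE_pmfI ennreal_leI)
    fix t assume "t \<in> set_pmf (iid_times n m D)"
    then have t: "t x \<in> {0, 1}" for x
      using iid_times_range[of t n m D x] D by auto
    show "OPT n m t \<le> f t"
      using OPT_le[of n t m, OF n t] by (simp add: f_def card_eq)
  qed
  also have "\<dots> = ennreal (measure_pmf.expectation (iid_times n m D) f)"
    using int
    by (intro nn_integral_eq_integral) (auto simp: f_def intro!: add_nonneg_nonneg divide_nonneg_nonneg sum_nonneg)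
  also have "measure_pmf.expectation (iid_times n m D) f =
      (\<Sum>j\<in>{1..m}. measure_pmf.prob (iid_times n m D) {t. j \<in> slow_tasks n m t}) / real n + 1"
    unfolding f_def by (simp add: measure_pmf.emeasure_eq_measure)
  also have "\<dots> = real m * pmf D 1 ^ n / real n + 1"
    by (simp add: prob_slow_task)
  finally show ?thesis .
qed

lemma expected_OPT_pos:
  assumes n: "n \<ge> 1" and m: "m \<ge> 1" and D: "1 \<in> set_pmf D"
  shows "0 < expected_OPT n m D"
proof -
  \<comment> \<open>This all-ones matrix has positive probability, and under any assignment the
    machine holding task 1 has load at least 1.\<close>
  define t :: "nat \<times> nat \<Rightarrow> real" where "t = (\<lambda>x. if x \<in> {1..n} \<times> {1..m} then 1 else 0)"
  have t: "t \<in> set_pmf (iid_times n m D)"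
    using D by (auto simp: iid_times_def set_Pi_pmf PiE_dflt_def t_def)
  obtain a where a: "a \<in> {1..m} \<rightarrow>\<^sub>E {1..n}" "OPT n m t = makespan n m t a"
    using Min_in[OF finite_makespans makespans_nonempty[OF n], of m t] unfolding OPT_def by auto
  have a1: "a 1 \<in> {1..n}" using a(1) m by auto
  have "1 = t (a 1, 1)" using a1 m by (simp add: t_def)
  also have "\<dots> \<le> (\<Sum>j | j \<in> {1..m} \<and> a j = a 1. t (a 1, j))"
    using m by (intro member_le_sum) (auto simp: t_def)
  also have "\<dots> \<le> makespan n m t a" using a1 by (rule makespan_ge)
  finally have "OPT n m t \<ge> 1" by (simp add: a)
  then have "ennreal (OPT n m t) \<noteq> 0" by simp
  moreover have "ennreal (OPT n m t) = 0" if "expected_OPT n m D = 0"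
    using that t by (auto simp: expected_OPT_def nn_integral_0_iff_AE AE_measure_pmf_iff)
  ultimately show ?thesis by (auto simp: zero_less_iff_neq_zero)
qed

section \<open>The ratio and the choice of \<open>k\<close>\<close>

lemma two_point_ratio_ge:
  assumes "n \<le> m" "1 \<le> k" "exp 1 * real k ^ k \<le> real n"
  defines "D \<equiv> two_point (root n (real n / real m))"
  shows "0 < expected_OPT n m D" "expected_OPT n m D < \<infinity>"
    and "ennreal (real k / 20) \<le> expected_VCG n m D / expected_OPT n m D"
proof -
  have "0 < exp 1 * real k ^ k" using assms(2) by simp
  then have n: "n \<ge> 1" using assms(3) by linarith
  then have m: "m \<ge> 1" using assms(1) by simp
  \<comment> \<open>\<open>n \<le> m\<close> makes \<open>q\<close> a probability. With
    \<open>q ^ n = n / m\<close> the bound on the expected optimum becomes \<open>1 + 1 = 2\<close>,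
    and each bin gets probability \<open>1 / m\<close>, so VCG costs at least
    \<open>k / 10\<close>.\<close>
  define q where "q = root n (real n / real m)"
  have q: "0 < q" "q \<le> 1" "q ^ n = real n / real m"
    using n m assms(1) by (auto simp: q_def real_root_gt_0_iff real_root_le_1_iff)
  have pmf1: "pmf D 1 = q" using q by (simp add: D_def q_def[symmetric] pmf_two_point_one)
  have D1: "1 \<in> set_pmf D" using q pmf1 by (simp add: set_pmf_iff)
  have D01: "set_pmf D \<subseteq> {0, 1}" using set_two_point by (simp add: D_def)
  show pos: "0 < expected_OPT n m D" using n m D1 by (rule expected_OPT_pos)
  have opt: "expected_OPT n m D \<le> ennreal 2"
    using expected_OPT_le[OF n D01, of m] n m by (simp add: pmf1 q)
  then show "expected_OPT n m D < \<infinity>"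
    by (metis ennreal_less_top infinity_ennreal_def le_less_trans)
  have "real k / 10 \<le> real k * measure_pmf.prob (Pi_pmf {1..m} 0 (\<lambda>_. slow_bin n D))
      {z. \<exists>i\<in>{1..n}. k \<le> card {j \<in> {1..m}. z j = i}}"
    using mult_left_mono[OF balls_into_bins_prob_ge[OF assms(1-3), of "slow_bin n D"], of "real k"] n m
    by (simp add: pmf_slow_bin pmf1 q)
  then have vcg: "ennreal (real k / 10) \<le> expected_VCG n m D"
    using D01 by (intro order.trans[OF ennreal_leI expected_VCG_ge[OF n]]) auto
  obtain r where r: "expected_OPT n m D = ennreal r" "0 < r" "r \<le> 2"
    using pos opt by (cases "expected_OPT n m D") (auto simp: top_unique ennreal_le_iff simp del: ennreal_numeral)
  have "real k / 20 \<le> real k / 10 / r"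
    using mult_left_mono[of r 2 "real k"] r by (simp add: field_simps)
  then have "ennreal (real k / 20) \<le> ennreal (real k / 10) / expected_OPT n m D"
    using r by (simp add: divide_ennreal ennreal_leI)
  also have "\<dots> \<le> expected_VCG n m D / expected_OPT n m D"
    using vcg by (rule divide_right_mono_ennreal)
  finally show "ennreal (real k / 20) \<le> expected_VCG n m D / expected_OPT n m D" .
qed

text \<open>With \<open>x = ln n\<close>, the requirement on \<open>k\<close> reads
  \<open>1 + k * ln k \<le> x\<close>. For \<open>x \<ge> 2\<close> the choice of \<open>k\<close>
  near \<open>x / (2 * ln x)\<close> keeps \<open>k * ln k \<le> x / 2\<close>, leaving room for the
  1. For \<open>x < 2\<close> the target is bounded, and \<open>k = 1\<close> suffices.\<close>

lemma exists_bin_load: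
  fixes n :: nat
  assumes n: "n \<ge> 3"
  obtains k :: nat where "1 \<le> k" "exp 1 * real k ^ k \<le> real n"
    "min (1 / 4) (ln (ln 3) / 2) * (ln (real n) / ln (ln (real n))) \<le> real k"
proof (cases "ln (real n) \<ge> 2")
  case True
  define x where "x = ln (real n)"
  define k where "k = nat \<lfloor>x / (2 * ln x)\<rfloor>"
  have x: "x \<ge> 2" using True by (simp add: x_def)
  \<comment> \<open>Leads to \<open>2 * ln x \<le> x\<close>, so that the rounded value
    \<open>k\<close> is at least 1.\<close>
  have "ln (x / 2) \<le> x / 2 - 1" using x by (intro ln_le_minus_one) auto
  then have lnx: "ln x \<le> x / 2" using x ln_2_less_1 by (simp add: ln_div)
  have "ln 2 \<le> ln x" using x by simp
  then have lnx2: "1 \<le> 2 * ln x" using ln2_ge_two_thirds by linarith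
  have ge1: "1 \<le> x / (2 * ln x)" using lnx lnx2 by (subst le_divide_eq_1_pos) linarith+
  have k: "real k \<le> x / (2 * ln x)" "x / (2 * ln x) < real k + 1" 
    using ge1 unfolding k_def by linarith+
  have k1: "1 \<le> k" using ge1 unfolding k_def by linarith
  have "x / (2 * ln x) \<le> x" using lnx2 x by (simp add: field_simps mult_le_cancel_left1)
  then have "ln (real k) \<le> ln x" using k k1 x by (intro ln_mono) auto
  then have "real k * ln (real k) \<le> x / (2 * ln x) * ln x"
    using k k1 lnx2 x by (intro mult_mono) auto
  also have "\<dots> = x / 2" using lnx2 by simp
  finally have "1 + real k * ln (real k) \<le> x" using x by simp
  then have "exp (1 + real k * ln (real k)) \<le> exp x" by simp
  then have "exp 1 * real k ^ k \<le> real n"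
    using k1 n by (simp add: exp_add exp_of_nat_mult x_def)
  moreover have "min (1 / 4) (ln (ln 3) / 2) * (x / ln x) \<le> 1 / 4 * (x / ln x)"
    using x lnx2 by (intro mult_right_mono) auto
  \<comment> \<open>Rounding down loses at most a factor 2, because
    \<open>x / (2 * ln x) < k + 1 \<le> 2 * k\<close>.\<close>
  moreover have "1 / 4 * (x / ln x) \<le> real k" using k k1 by simp
  ultimately show ?thesis using k1 that[of k] by (simp add: x_def)
next
  case False
  have "ln 3 \<le> ln (real n)" using n by (intro ln_mono) auto
  then have le: "ln (ln 3) \<le> ln (ln (real n))" using ln3_gt_1 n by (intro ln_mono) auto
  have pos: "0 < ln (ln 3 :: real)" using ln3_gt_1 by simp
  have "1 < ln (real n)" using ln3_gt_1 \<open>ln 3 \<le> ln (real n)\<close> by (rule less_le_trans)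
  then have ln_n: "0 \<le> ln (real n)" "0 < ln (ln (real n))" by (linarith, rule ln_gt_zero)
  \<comment> \<open>Here \<open>ln n < 2\<close> and \<open>ln (ln n) \<ge> ln (ln 3) > 0\<close>,
    so the second entry of the minimum scales the quotient down to at most 1.\<close>
  have "min (1 / 4) (ln (ln 3) / 2) * (ln (real n) / ln (ln (real n))) \<le>
      ln (ln 3) / 2 * (2 / ln (ln 3))"
    using False ln_n le pos by (intro mult_mono frac_le divide_nonneg_nonneg) linarith+
  also have "\<dots> = 1" using pos by simp
  finally show ?thesis using that[of 1] n exp_le by simp
qed

theorem theorem11:
  "\<forall>C::real. C > 0 \<longrightarrow>
     (\<exists>c::real. c > 0 \<and>
       (\<forall>n m :: nat. 3 \<le> n \<and> n \<le> m \<and> real m \<le> C * real n * exp (real n) \<longrightarrow>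
         (\<exists>D :: real pmf. set_pmf D \<subseteq> {0..} \<and> MHR D \<and>
            0 < expected_OPT n m D \<and> expected_OPT n m D < \<infinity> \<and>
            expected_VCG n m D / expected_OPT n m D
              \<ge> ennreal (c * (ln (real n) / ln (ln (real n)))))))"
proof (intro allI impI)
  define c :: real where "c = min (1 / 4) (ln (ln 3) / 2)"
  have "c > 0" using ln3_gt_1 by (simp add: c_def)
  fix C :: real
  show "\<exists>c::real. c > 0 \<and>
       (\<forall>n m :: nat. 3 \<le> n \<and> n \<le> m \<and> real m \<le> C * real n * exp (real n) \<longrightarrow>
         (\<exists>D :: real pmf. set_pmf D \<subseteq> {0..} \<and> MHR D \<and>
            0 < expected_OPT n m D \<and> expected_OPT n m D < \<infinity> \<and>
            expected_VCG n m D / expected_OPT n m D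
              \<ge> ennreal (c * (ln (real n) / ln (ln (real n))))))"
  \<comment> \<open>\<open>c\<close> relates \<open>k\<close> to \<open>ln n / ln (ln n)\<close>;
    the 20 is the loss in \<open>two_point_ratio_ge\<close>, a factor 10 from VCG and 2 from the
    optimum.\<close>
  proof (intro exI[of _ "c / 20"] conjI allI impI)
    show "c / 20 > 0" using \<open>c > 0\<close> by simp
    fix n m :: nat
    assume nm: "3 \<le> n \<and> n \<le> m \<and> real m \<le> C * real n * exp (real n)"
    then obtain k where k: "1 \<le> k" "exp 1 * real k ^ k \<le> real n"
        "c * (ln (real n) / ln (ln (real n))) \<le> real k"
      using exists_bin_load[of n] unfolding c_def by blast
    have "ennreal (c / 20 * (ln (real n) / ln (ln (real n)))) \<le> ennreal (real k / 20)"
      using k(3) by (intro ennreal_leI) simp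
    also have "\<dots> \<le> expected_VCG n m (two_point (root n (real n / real m))) /
        expected_OPT n m (two_point (root n (real n / real m)))"
      using nm k by (intro two_point_ratio_ge) auto
    finally have ratio: "ennreal (c / 20 * (ln (real n) / ln (ln (real n)))) \<le> \<dots>" .
    have "set_pmf (two_point q) \<subseteq> {0..}" for q
      using set_two_point[of q] by auto
    with ratio show "\<exists>D :: real pmf. set_pmf D \<subseteq> {0..} \<and> MHR D \<and>
            0 < expected_OPT n m D \<and> expected_OPT n m D < \<infinity> \<and>
            expected_VCG n m D / expected_OPT n m D
              \<ge> ennreal (c / 20 * (ln (real n) / ln (ln (real n))))"
      using nm two_point_ratio_ge(1,2)[OF _ k(1,2), of m]
      by (intro exI[of _ "two_point (root n (real n / real m))"] conjI MHR_two_point) simp_all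
  qed
qed

end
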